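(* Let $X$ be a finite nonempty set, let $k\ge 1$ be an integer and let $a\in X$ be arbitrary. Then $$\mathbf V_k(X)=\mathbf V_k(X\setminus\{a\})\rtimes_\infty\mathbf V_{k-1}(X),$$ where $\mathbf V_{k-1}(X)$ is identified with its isomorphic copy whose points are the $k$-element multisets $f$ over $X$ with $a\in\mathrm{supp}(f)$ and whose lines are the multisets $e$ over $X$ with $|e|<k$ and $a\in\mathrm{supp}(e)$, via multiplication by $a$ (a point $g$ of $\mathbf V_{k-1}(X)$ is sent to $g\,a$ and a line $e'$ of $\mathbf V_{k-1}(X)$ to $e'\,a$), and where the map $\infty$ from the lines of $\mathbf V_k(X\setminus\{a\})$ to the points of this copy of $\mathbf V_{k-1}(X)$ is $e\longmapsto e^\infty=e\,a^{k-|e|}$.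
   Context: An incidence structure $\langle U,\mathcal L,\mathrel{|}\rangle$ consists of a set $U$ of points, a set $\mathcal L$ of lines and an incidence relation $\mathrel{|}\subset U\times\mathcal L$. It is a partial linear space if, whenever points $p,q$ are both incident with lines $A,B$, then $p=q$ or $A=B$. A multiset over a finite set $X$ is a function $f\colon X\to\{0,1,2,\dots\}$, written multiplicatively as $f=\prod_{x\in X}x^{f(x)}$ (so the product of multisets is the pointwise sum of functions, and $1$ is the zero function). Its cardinality is $|f|=\sum_{x\in X}f(x)$ and $\mathrm{supp}(f)=\{x\in X\colon f(x)>0\}$. A multiset over $X\setminus\{a\}$ is regarded as a multiset over $X$ whose support does not contain $a$. Let $\mathfrak y_k(X)$ be the set of multisets over $X$ of cardinality $k$ and $\mathfrak y_{<k}(X)=\bigcup_{i=0}^{k-1}\mathfrak y_i(X)$. The combinatorial Veronesian $\mathbf V_k(X)$ is the incidence structure with point set $\mathfrak y_k(X)$, line set $\mathfrak y_{<k}(X)$, in which a point $f$ is incident with a line $e$ iff $f=e\,x^{k-|e|}$ for some $x\in X$. It is a partial linear space. Given partial linear spaces $\mathfrak K_i=\langle U_i,\mathcal L_i,\mathrel{|_i}\rangle$, $i=1,2$, with $U_1\cap U_2=\emptyset=\mathcal L_1\cap\mathcal L_2$, and a map $\infty\colon\mathcal L_1\to U_2$, $A\mapsto A^\infty$, such that two lines $A,B\in\mathcal L_1$ which have a common point in $U_1$ and satisfy $A^\infty=B^\infty$ are equal, the structure $\mathfrak K_1\rtimes_\infty\mathfrak K_2$ is $\langle U_1\cup U_2,\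 \mathcal L_1\cup\mathcal L_2,\ \mathrel{|_1}\cup\mathrel{|_2}\cup\{(A^\infty,A)\colon A\in\mathcal L_1\}\rangle$. *)

theory Defs
  imports "HOL-Library.Multiset" "HOL-Library.FuncSet"
begin

section \<open>Incidence structures\<close>

record ('p, 'l) incidence_structure =
  points :: "'p set"
  lines :: "'l set"
  inc :: "('p \<times> 'l) set"

definition is_incidence_structure :: "('p, 'l) incidence_structure \<Rightarrow> bool" where
  "is_incidence_structure K \<longleftrightarrow> inc K \<subseteq> points K \<times> lines K"

definition partial_linear_space :: "('p, 'l) incidence_structure \<Rightarrow> bool" where
  "partial_linear_space K \<longleftrightarrow> is_incidence_structure K \<and>
     (\<forall>p\<in>points K. \<forall>q\<in>points K. \<forall>A\<in>lines K. \<forall>B\<in>lines K.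
        (p, A) \<in> inc K \<and> (q, A) \<in> inc K \<and> (p, B) \<in> inc K \<and> (q, B) \<in> inc K \<longrightarrow> p = q \<or> A = B)"

definition is_isomorphism ::
  "('p \<Rightarrow> 'q) \<Rightarrow> ('l \<Rightarrow> 'm) \<Rightarrow> ('p, 'l) incidence_structure \<Rightarrow> ('q, 'm) incidence_structure \<Rightarrow> bool" where
  "is_isomorphism \<phi> \<psi> K M \<longleftrightarrow>
     bij_betw \<phi> (points K) (points M) \<and> bij_betw \<psi> (lines K) (lines M) \<and>
     (\<forall>p\<in>points K. \<forall>A\<in>lines K. (p, A) \<in> inc K \<longleftrightarrow> (\<phi> p, \<psi> A) \<in> inc M)"

text \<open>Transport of structure; an isomorphic copy when the two maps are injective.\<close>

definition image_structure ::
  "('p \<Rightarrow> 'q) \<Rightarrow> ('l \<Rightarrow> 'm) \<Rightarrow> ('p, 'l) incidence_structure \<Rightarrow> ('q, 'm) incidence_structure" where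
  "image_structure \<phi> \<psi> K =
     \<lparr> points = \<phi> ` points K, lines = \<psi> ` lines K, inc = map_prod \<phi> \<psi> ` inc K \<rparr>"


section \<open>Joining two structures along a map at infinity\<close>

text \<open>
  The standing assumptions under which the join \<open>K\<^sub>1 \<rtimes>\<^sub>\<infinity> K\<^sub>2\<close> is defined. The map \<open>\<infinity>\<close> is a
  total function of which only the values on \<open>lines K\<^sub>1\<close> matter.
\<close>

definition joinable ::
  "('p, 'l) incidence_structure \<Rightarrow> ('l \<Rightarrow> 'p) \<Rightarrow> ('p, 'l) incidence_structure \<Rightarrow> bool" where
  "joinable K1 infty K2 \<longleftrightarrow>
     partial_linear_space K1 \<and> partial_linear_space K2 \<and>
     points K1 \<inter> points K2 = {} \<and> lines K1 \<inter> lines K2 = {} \<and>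
     infty \<in> lines K1 \<rightarrow> points K2 \<and>
     (\<forall>A\<in>lines K1. \<forall>B\<in>lines K1.
        (\<exists>p\<in>points K1. (p, A) \<in> inc K1 \<and> (p, B) \<in> inc K1) \<and> infty A = infty B \<longrightarrow> A = B)"

definition join ::
  "('p, 'l) incidence_structure \<Rightarrow> ('l \<Rightarrow> 'p) \<Rightarrow> ('p, 'l) incidence_structure
     \<Rightarrow> ('p, 'l) incidence_structure" where
  "join K1 infty K2 =
     \<lparr> points = points K1 \<union> points K2,
       lines = lines K1 \<union> lines K2,
       inc = inc K1 \<union> inc K2 \<union> {(infty A, A) | A. A \<in> lines K1} \<rparr>"


section \<open>Combinatorial Veronesians\<close>

text \<open>
  A multiset over \<open>X\<close> is a library multiset with support \<^term>\<open>set_mset f\<close> contained in \<open>X\<close>;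
  the multiplicative notation becomes additive: the product \<open>f g\<close> is \<^term>\<open>f + g\<close>, the power
  \<open>x\<close> to the \<open>n\<close> is \<^term>\<open>replicate_mset n x\<close>, and multiplication by \<open>a\<close> is \<^term>\<open>add_mset a\<close>.
\<close>

definition multisets_below :: "'a set \<Rightarrow> nat \<Rightarrow> 'a multiset set" where
  "multisets_below X k = (\<Union>i<k. multisets_of_size X i)"

definition veronesian :: "nat \<Rightarrow> 'a set \<Rightarrow> ('a multiset, 'a multiset) incidence_structure" where
  "veronesian k X =
     \<lparr> points = multisets_of_size X k,
       lines = multisets_below X k,
       inc = {(f, e). f \<in> multisets_of_size X k \<and> e \<in> multisets_below X k \<and>
                (\<exists>x\<in>X. f = e + replicate_mset (k - size e) x)} \<rparr>"

end

theory Submission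
  imports Defs
begin

text \<open>
  Two distinct points \<open>f\<close>, \<open>g\<close> of a line \<open>e\<close> of a Veronesian determine it as their meet
  \<open>e = f \<inter># g\<close>, so Veronesians are partial linear spaces. A line containing \<open>a\<close> has only points
  containing \<open>a\<close>, and dividing by \<open>a\<close> maps both into the Veronesian of level \<open>k - 1\<close>; a line \<open>e\<close>
  avoiding \<open>a\<close> has exactly one point that contains \<open>a\<close>, namely its point at infinity, and \<open>e\<close> is
  recovered from that point by deleting all copies of \<open>a\<close>.
\<close>

text \<open>An image pair comes from some pair in \<open>inc K\<close>; well-formedness puts that
  pair where both maps are injective, so it is the pair one started with.\<close>

lemma is_isomorphism_image_structure:
  assumes "is_incidence_structure K" "inj_on \<phi> (points K)" "inj_on \<psi> (lines K)"
  shows "is_isomorphism \<phi> \<psi> K (image_structure \<phi> \<psi> K)"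
  using assms
  unfolding is_isomorphism_def image_structure_def is_incidence_structure_def bij_betw_def
  by (fastforce dest: inj_onD)

text \<open>An isomorphism only compares incidences between points and lines, so it cannot exclude
  stray pairs in \<open>inc M\<close>; hence the separate assumption on \<open>M\<close>.\<close>

lemma partial_linear_space_iso:
  assumes K: "partial_linear_space K" and iso: "is_isomorphism \<phi> \<psi> K M"
    and M: "is_incidence_structure M"
  shows "partial_linear_space M"
proof -
  have pts: "points M = \<phi> ` points K" and lns: "lines M = \<psi> ` lines K"
    and inc: "\<And>p A. p \<in> points K \<Longrightarrow> A \<in> lines K \<Longrightarrow> (\<phi> p, \<psi> A) \<in> inc M \<longleftrightarrow> (p, A) \<in> inc K"
    using iso unfolding is_isomorphism_def bij_betw_def by auto
  show ?thesis
    using K M unfolding partial_linear_space_def pts lns by (simp add: inc) blast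
qed

lemma is_incidence_structure_image_structure:
  "is_incidence_structure K \<Longrightarrow> is_incidence_structure (image_structure \<phi> \<psi> K)"
  unfolding is_incidence_structure_def image_structure_def by auto

lemma multisets_below_iff: "e \<in> multisets_below X k \<longleftrightarrow> set_mset e \<subseteq> X \<and> size e < k"
  by (auto simp: multisets_below_def multisets_of_size_def)

text \<open>Each element gets extra copies from at most one of the two powers, so the minimum of the
  counts is its count in \<open>e\<close>.\<close>

lemma add_replicate_mset_inter:
  assumes "x \<noteq> y"
  shows "(e + replicate_mset m x) \<inter># (e + replicate_mset n y) = e"
  using assms by (intro multiset_eqI) auto

lemma is_incidence_structure_veronesian: "is_incidence_structure (veronesian k X)"
  by (auto simp: is_incidence_structure_def veronesian_def)

lemma veronesian_line_eq_inter:
  assumes "(f, e) \<in> inc (veronesian k X)" "(g, e) \<in> inc (veronesian k X)" "f \<noteq> g"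
  shows "e = f \<inter># g"
proof -
  obtain x y where "f = e + replicate_mset (k - size e) x" "g = e + replicate_mset (k - size e) y"
    using assms(1,2) by (auto simp: veronesian_def)
  \<comment> \<open>Both powers have the same exponent, so \<open>f \<noteq> g\<close> forces
    \<open>x \<noteq> y\<close>.\<close>
  with \<open>f \<noteq> g\<close> show ?thesis
    by (metis add_replicate_mset_inter)
qed

lemma partial_linear_space_veronesian: "partial_linear_space (veronesian k X)"
  unfolding partial_linear_space_def
  by (metis is_incidence_structure_veronesian veronesian_line_eq_inter)

lemma image_add_mset_multisets_of_size:
  assumes "a \<in> X"
  shows "add_mset a ` multisets_of_size X k = {f \<in> multisets_of_size X (Suc k). a \<in># f}"
  using assms by (fastforce simp: multisets_of_size_def dest: multi_member_split)

lemma image_add_mset_multisets_below: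
  assumes "a \<in> X"
  shows "add_mset a ` multisets_below X k = {e \<in> multisets_below X (Suc k). a \<in># e}"
  using assms by (fastforce simp: multisets_below_iff dest: multi_member_split)

text \<open>Level and line size both grow by one, so the exponent \<open>k - size e\<close> is
  unchanged.\<close>

lemma inc_veronesian_add_mset:
  assumes "a \<in> X"
  shows "(add_mset a f, add_mset a e) \<in> inc (veronesian (Suc k) X) \<longleftrightarrow> (f, e) \<in> inc (veronesian k X)"
  using assms by (auto simp: veronesian_def multisets_below_iff multisets_of_size_def)

lemma inc_image_veronesian:
  assumes "a \<in> X"
  shows "inc (image_structure (add_mset a) (add_mset a) (veronesian k X)) =
    {(f, e) \<in> inc (veronesian (Suc k) X). a \<in># e}"
proof (intro set_eqI iffI)
  fix z assume "z \<in> inc (image_structure (add_mset a) (add_mset a) (veronesian k X))"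
  with assms show "z \<in> {(f, e) \<in> inc (veronesian (Suc k) X). a \<in># e}"
    by (auto simp: image_structure_def inc_veronesian_add_mset)
next
  fix z assume "z \<in> {(f, e) \<in> inc (veronesian (Suc k) X). a \<in># e}"
  then obtain f e where z: "z = (f, e)" "(f, e) \<in> inc (veronesian (Suc k) X)" and "a \<in># e"
    by auto
  moreover from this have "a \<in># f"
    by (auto simp: veronesian_def)
  ultimately obtain f' e' where "f = add_mset a f'" "e = add_mset a e'"
    by (meson multi_member_split)
  with z assms show "z \<in> inc (image_structure (add_mset a) (add_mset a) (veronesian k X))"
    by (auto simp: image_structure_def inc_veronesian_add_mset)
qed

text \<open>The base \<open>x\<close> of the added power decides: \<open>x = a\<close> gives the
  point at infinity, any other \<open>x\<close> an incidence over \<open>X - {a}\<close>.\<close>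

lemma inc_veronesian_avoiding:
  assumes "a \<in> X"
  shows "{(f, e) \<in> inc (veronesian k X). a \<notin># e} =
    inc (veronesian k (X - {a})) \<union>
    {(e + replicate_mset (k - size e) a, e) | e. e \<in> multisets_below (X - {a}) k}"
    (is "?L = ?R")
proof
  show "?L \<subseteq> ?R"
  proof (rule subrelI)
    fix f e assume "(f, e) \<in> ?L"
    then obtain x where x: "x \<in> X" "f = e + replicate_mset (k - size e) x"
      and f: "f \<in> multisets_of_size X k" and e: "e \<in> multisets_below (X - {a}) k"
      by (auto simp: veronesian_def multisets_below_iff)
    show "(f, e) \<in> ?R"
    proof (cases "x = a")
      case True
      with x e show ?thesis by blast
    next
      case False
      with x f e have "(f, e) \<in> inc (veronesian k (X - {a}))"
        by (auto simp: veronesian_def multisets_below_iff multisets_of_size_def)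
      then show ?thesis by blast
    qed
  qed
  show "?R \<subseteq> ?L"
    using assms by (auto simp: veronesian_def multisets_below_iff multisets_of_size_def)
qed

text \<open>Deleting \<open>a\<close> recovers \<open>e\<close>. The exponents may differ because
  lines with the same point at infinity are not known in advance to have equal size.\<close>

lemma replicate_mset_add_cancel:
  assumes "e + replicate_mset m a = e' + replicate_mset n a" "a \<notin># e" "a \<notin># e'"
  shows "e = e'"
proof -
  have "filter_mset (\<lambda>x. x \<noteq> a) (e + replicate_mset m a) =
        filter_mset (\<lambda>x. x \<noteq> a) (e' + replicate_mset n a)"
    using assms(1) by simp
  moreover have "filter_mset (\<lambda>x. x \<noteq> a) (d + replicate_mset n a) = d" if "a \<notin># d" for d n
    using that by (intro multiset_eqI) (auto simp: not_in_iff)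
  ultimately show ?thesis
    using assms(2,3) by simp
qed

theorem proposition3p2:
  fixes X :: "'a set" and k :: nat and a :: 'a
  assumes "finite X" and "X \<noteq> {}" and "k \<ge> 1" and "a \<in> X"
  shows
    "let K1 = veronesian k (X - {a});
         K2 = image_structure (add_mset a) (add_mset a) (veronesian (k - 1) X);
         infty = (\<lambda>e. e + replicate_mset (k - size e) a)
     in is_isomorphism (add_mset a) (add_mset a) (veronesian (k - 1) X) K2 \<and>
        points K2 = {f \<in> multisets_of_size X k. a \<in> set_mset f} \<and>
        lines K2 = {e \<in> multisets_below X k. a \<in> set_mset e} \<and>
        joinable K1 infty K2 \<and>
        veronesian k X = join K1 infty K2"
proof -
  define K1 where "K1 = veronesian k (X - {a})"
  define K2 where "K2 = image_structure (add_mset a) (add_mset a) (veronesian (k - 1) X)"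
  define infty where "infty = (\<lambda>e. e + replicate_mset (k - size e) a)"
  \<comment> \<open>The lemmas above relate levels \<open>k\<close> and \<open>Suc k\<close>; they
    are applied at \<open>k - 1\<close>, where truncated subtraction requires
    \<open>k \<ge> 1\<close>.\<close>
  have Suc_k: "Suc (k - 1) = k"
    using \<open>k \<ge> 1\<close> by simp
  have points1: "points K1 = multisets_of_size (X - {a}) k"
    and lines1: "lines K1 = multisets_below (X - {a}) k"
    by (simp_all add: K1_def veronesian_def)
  have points2: "points K2 = {f \<in> multisets_of_size X k. a \<in># f}"
    using image_add_mset_multisets_of_size[OF \<open>a \<in> X\<close>, of "k - 1"]
    unfolding Suc_k by (simp add: K2_def image_structure_def veronesian_def)
  have lines2: "lines K2 = {e \<in> multisets_below X k. a \<in># e}"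
    using image_add_mset_multisets_below[OF \<open>a \<in> X\<close>, of "k - 1"]
    unfolding Suc_k by (simp add: K2_def image_structure_def veronesian_def)
  have inc2: "inc K2 = {(f, e) \<in> inc (veronesian k X). a \<in># e}"
    using inc_image_veronesian[OF \<open>a \<in> X\<close>, of "k - 1"] unfolding Suc_k K2_def .
  have iso: "is_isomorphism (add_mset a) (add_mset a) (veronesian (k - 1) X) K2"
    unfolding K2_def
    by (intro is_isomorphism_image_structure is_incidence_structure_veronesian)
      (simp_all add: inj_on_def)
  have "partial_linear_space K2"
    using partial_linear_space_veronesian iso unfolding K2_def
    by (rule partial_linear_space_iso)
      (intro is_incidence_structure_image_structure is_incidence_structure_veronesian)
  moreover have "partial_linear_space K1"
    unfolding K1_def by (rule partial_linear_space_veronesian)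
  \<comment> \<open>A line has size below \<open>k\<close>, so the exponent is positive and
    \<open>a\<close> does occur.\<close>
  moreover have "infty \<in> lines K1 \<rightarrow> points K2"
    using \<open>a \<in> X\<close>
    by (auto simp: lines1 points2 infty_def multisets_below_iff multisets_of_size_def)
  \<comment> \<open>Injectivity of \<open>infty\<close> on \<open>lines K1\<close> yields the
    separation condition of \<open>joinable\<close>.\<close>
  moreover have "A = B" if "A \<in> lines K1" "B \<in> lines K1" "infty A = infty B" for A B
    using that unfolding infty_def lines1 multisets_below_iff
    by (blast intro: replicate_mset_add_cancel)
  moreover have "points K1 \<inter> points K2 = {}" "lines K1 \<inter> lines K2 = {}"
    by (auto simp: points1 lines1 points2 lines2 multisets_below_iff multisets_of_size_def)
  ultimately have "joinable K1 infty K2"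
    by (auto simp: joinable_def)
  moreover have "veronesian k X = join K1 infty K2"
  proof (rule incidence_structure.equality)
    show "points (veronesian k X) = points (join K1 infty K2)"
      by (auto simp: join_def points1 points2 veronesian_def multisets_of_size_def)
    show "lines (veronesian k X) = lines (join K1 infty K2)"
      by (auto simp: join_def lines1 lines2 veronesian_def multisets_below_iff)
    \<comment> \<open>Incidences are split by whether the line contains \<open>a\<close>; those
      avoiding it supply \<open>inc K1\<close> and the pairs at infinity.\<close>
    have "inc (veronesian k X) = {(f, e) \<in> inc (veronesian k X). a \<notin># e} \<union> inc K2"
      unfolding inc2 by auto
    then show "inc (veronesian k X) = inc (join K1 infty K2)"
      unfolding inc_veronesian_avoiding[OF \<open>a \<in> X\<close>]
      by (simp add: join_def lines1 infty_def Un_ac flip: K1_def)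
  \<comment> \<open>What remains is the record extension field, of type \<open>unit\<close>.\<close>
  qed simp
  ultimately show ?thesis
    using iso points2 lines2 unfolding Let_def K1_def K2_def infty_def by blast
qed

end
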